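(* Let $X$ and $Y$ be two Banach spaces, let $1\le p<\infty$, and let $Z=X\oplus_p Y$. Then $Z$ has $BHP$ if and only if $X$ or $Y$ has $BHP$.
   Context: All Banach spaces are real and nontrivial. For a Banach space $E$, $B_E$ is the closed unit ball. $E$ has the Ball Huskable Property ($BHP$) if for every $\varepsilon>0$ there is a nonempty relatively weakly open subset of $B_E$ with diameter less than $\varepsilon$. $X\oplus_p Y$ is $X\times Y$ with norm $\|(x,y)\|=(\|x\|^p+\|y\|^p)^{1/p}$. *)

theory Defs
  imports "HOL-Analysis.Analysis"
begin

text \<open>
  The norm of \<open>X \<oplus>\<^sub>p Y\<close> depends on the real number \<open>p\<close>, so it cannot be the norm of a type
  class instance on the product type (whose own norm is the one for \<open>p = 2\<close>). The notions below
  therefore take the norm \<open>N\<close> of the space as an explicit argument; for a Banach space given by a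
  type they are used with \<open>N = norm\<close>, in which case they agree with the library notions.
\<close>

definition dual_wrt :: "('a::real_vector \<Rightarrow> real) \<Rightarrow> ('a \<Rightarrow> real) set"
  where "dual_wrt N = {f. linear f \<and> (\<exists>K. \<forall>x. \<bar>f x\<bar> \<le> K * N x)}"

lemma dual_wrt_norm: "dual_wrt norm = {f :: 'a::real_normed_vector \<Rightarrow> real. bounded_linear f}"
  by (auto simp: dual_wrt_def bounded_linear_def bounded_linear_axioms_def mult.commute)

definition weak_topology :: "('a::real_vector \<Rightarrow> real) \<Rightarrow> 'a topology"
  where "weak_topology N = topology_generated_by {f -` V | f V. f \<in> dual_wrt N \<and> open V}"

lemma topspace_weak_topology: "topspace (weak_topology N) = UNIV" if "\<And>x. N x \<ge> 0"
proof -
  have "(\<lambda>_. 0) \<in> dual_wrt N"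
    using that by (auto simp: dual_wrt_def linear_iff intro: exI [of _ 0])
  then have "(\<lambda>_. 0 :: real) -` UNIV \<in> {f -` V | f V. f \<in> dual_wrt N \<and> open V}"
    by blast
  then show ?thesis
    unfolding weak_topology_def topology_generated_by_topspace by auto
qed

definition unit_ball :: "('a \<Rightarrow> real) \<Rightarrow> 'a set"
  where "unit_ball N = {x. N x \<le> 1}"

text \<open>Only meaningful for nonempty sets that are bounded with respect to \<open>N\<close>.\<close>

definition diameter_wrt :: "('a::real_vector \<Rightarrow> real) \<Rightarrow> 'a set \<Rightarrow> real"
  where "diameter_wrt N S = (SUP (x, y) \<in> S \<times> S. N (x - y))"

lemma diameter_wrt_norm: "S \<noteq> {} \<Longrightarrow> diameter_wrt norm S = diameter S"
  for S :: "'a::real_normed_vector set"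
  by (simp add: diameter_wrt_def diameter_def dist_norm case_prod_unfold)

definition BHP :: "('a::real_vector \<Rightarrow> real) \<Rightarrow> bool"
  where "BHP N \<longleftrightarrow>
    (\<forall>\<epsilon>>0. \<exists>W. openin (subtopology (weak_topology N) (unit_ball N)) W \<and> W \<noteq> {} \<and>
      diameter_wrt N W < \<epsilon>)"

definition psum_norm :: "real \<Rightarrow> 'a::real_normed_vector \<times> 'b::real_normed_vector \<Rightarrow> real"
  where "psum_norm p = (\<lambda>(x, y). (norm x powr p + norm y powr p) powr (1 / p))"

end

theory Submission
  imports Defs
begin

text \<open>
  Call \<open>x\<close> an \<open>\<epsilon>\<close>-point (\<open>small_point\<close>) if some weak neighbourhood of \<open>x\<close> meets the unit ball in a set within
  distance \<open>\<epsilon>\<close> of \<open>x\<close>; \<open>BHP\<close> says that the ball contains \<open>\<epsilon>\<close>-points for all \<open>\<epsilon> > 0\<close>. They can be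
  found with norm at least \<open>1 - \<epsilon>\<close>: a basic weak neighbourhood of an \<open>\<epsilon>\<close>-point \<open>x\<close> with
  \<open>\<parallel>x\<parallel> < 1 - \<epsilon>\<close> lies, by convexity, entirely in the \<open>\<epsilon>\<close>-ball around \<open>x\<close>, and translating it shows
  that every point is an \<open>\<epsilon>\<close>-point.

  If \<open>x\<close> is an \<open>\<epsilon>\<close>-point of \<open>X\<close> with norm almost 1, then points \<open>(x', y)\<close> of the unit ball of \<open>Z\<close>
  with \<open>x'\<close> weakly close to \<open>x\<close> have \<open>\<parallel>x'\<parallel>\<close> almost 1, hence small \<open>\<parallel>y\<parallel>\<close>; so \<open>(x, 0)\<close> is a
  \<open>\<delta>\<close>-point of \<open>Z\<close> with \<open>\<delta>\<close> small. Conversely, if \<open>(x, y)\<close> is an \<open>\<epsilon>\<close>-point of \<open>Z\<close> with norm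
  almost 1, then \<open>\<parallel>x\<parallel>\<close> or \<open>\<parallel>y\<parallel>\<close>, say \<open>\<parallel>x\<parallel>\<close>, is at least \<open>1/4\<close>, and \<open>x / \<parallel>x\<parallel>\<close> is a
  \<open>4\<epsilon>\<close>-point of \<open>X\<close>.
\<close>

section \<open>Basic weak neighbourhoods and \<epsilon>-points\<close>

definition weak_nbhd :: "('a::real_vector \<Rightarrow> real) set \<Rightarrow> real \<Rightarrow> 'a \<Rightarrow> 'a set"
  where "weak_nbhd F \<eta> x = {z. \<forall>f\<in>F. \<bar>f (z - x)\<bar> < \<eta>}"

text \<open>The centre may lie outside the unit ball, so that \<open>small_point_translate\<close>
  can speak of every vector. Measuring from the centre instead of by diameter costs a factor of at
  most 2.\<close>

definition small_point :: "('a::real_vector \<Rightarrow> real) \<Rightarrow> real \<Rightarrow> 'a \<Rightarrow> bool"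
  where "small_point N \<epsilon> x \<longleftrightarrow> (\<exists>F \<eta>. finite F \<and> F \<subseteq> dual_wrt N \<and> \<eta> > 0 \<and>
    (\<forall>y \<in> weak_nbhd F \<eta> x. N y \<le> 1 \<longrightarrow> N (y - x) \<le> \<epsilon>))"

lemma openin_weak_nbhd:
  assumes "\<And>x. N x \<ge> 0" "finite F" "F \<subseteq> dual_wrt N"
  shows "openin (weak_topology N) (weak_nbhd F \<eta> x)"
proof -
  have "openin (weak_topology N) (f -` ball (f x) \<eta>)" if "f \<in> F" for f
    unfolding weak_topology_def
    by (rule topology_generated_by_Basis) (use that assms(3) in auto)
  moreover have "openin (weak_topology N) UNIV"
    using topspace_weak_topology[of N] assms(1) by (metis openin_topspace)
  \<comment> \<open>Inserting \<open>UNIV\<close> keeps the intersected family nonempty when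
    \<open>F = {}\<close>.\<close>
  ultimately have "openin (weak_topology N) (\<Inter> (insert UNIV ((\<lambda>f. f -` ball (f x) \<eta>) ` F)))"
    using assms(2) by (intro openin_Inter) auto
  moreover have "\<Inter> (insert UNIV ((\<lambda>f. f -` ball (f x) \<eta>) ` F)) = weak_nbhd F \<eta> x"
  proof -
    have "f (z - x) = f z - f x" if "f \<in> F" for f z
      using assms(3) that by (auto simp: dual_wrt_def linear_diff)
    then show ?thesis
      by (auto simp: weak_nbhd_def dist_real_def abs_minus_commute)
  qed
  ultimately show ?thesis by simp
qed

text \<open>Induction on the generation of \<open>U\<close>: an intersection is handled by uniting
  the finite sets of functionals and taking the smaller radius.\<close>

lemma weak_nbhd_base:
  assumes "openin (weak_topology N) U" "x \<in> U"
  obtains F \<eta> where "finite F" "F \<subseteq> dual_wrt N" "\<eta> > 0" "weak_nbhd F \<eta> x \<subseteq> U"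
proof -
  have "generate_topology_on {f -` V | f V. f \<in> dual_wrt N \<and> open V} U"
    using assms(1) by (simp add: weak_topology_def openin_topology_generated_by_iff)
  then have "\<exists>F \<eta>. finite F \<and> F \<subseteq> dual_wrt N \<and> \<eta> > 0 \<and> weak_nbhd F \<eta> x \<subseteq> U"
    using assms(2)
  proof (induction rule: generate_topology_on.induct)
    case Empty
    then show ?case by simp
  next
    case (Int a b)
    obtain F1 e1 where 1: "finite F1" "F1 \<subseteq> dual_wrt N" "e1 > 0" "weak_nbhd F1 e1 x \<subseteq> a"
      using Int by auto
    obtain F2 e2 where 2: "finite F2" "F2 \<subseteq> dual_wrt N" "e2 > 0" "weak_nbhd F2 e2 x \<subseteq> b"
      using Int by auto
    have "weak_nbhd (F1 \<union> F2) (min e1 e2) x \<subseteq> a \<inter> b"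
      using 1(4) 2(4) by (auto simp: weak_nbhd_def)
    then show ?case
      using 1 2 by (intro exI[of _ "F1 \<union> F2"] exI[of _ "min e1 e2"]) auto
  next
    case (UN K)
    then show ?case by (meson UnionE Union_upper subset_trans)
  next
    case (Basis s)
    then obtain f V where s: "s = f -` V" "f \<in> dual_wrt N" "open V" by blast
    then obtain e where e: "e > 0" "ball (f x) e \<subseteq> V"
      using Basis.prems by (auto simp: open_contains_ball)
    have "f (z - x) = f z - f x" for z
      using s(2) by (auto simp: dual_wrt_def linear_diff)
    then have "weak_nbhd {f} e x \<subseteq> s"
      using s(1) e(2) by (auto simp: weak_nbhd_def dist_real_def abs_minus_commute subset_iff)
    then show ?case
      using s(2) e(1) by (intro exI[of _ "{f}"] exI[of _ e]) auto
  qed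
  then show thesis using that by blast
qed

section \<open>Small points of the unit ball of a seminorm\<close>

text \<open>Serves both \<open>norm\<close> and \<open>psum_norm p\<close>, the latter not being a
  type class norm.\<close>

locale seminorm =
  fixes N :: "'a::real_vector \<Rightarrow> real"
  assumes triangle: "N (x + y) \<le> N x + N y"
    and scale: "N (a *\<^sub>R x) = \<bar>a\<bar> * N x"
begin

lemma zero [simp]: "N 0 = 0"
  using scale[of 0 0] by simp

lemma minus [simp]: "N (- x) = N x"
  using scale[of "-1" x] by simp

lemma nonneg: "N x \<ge> 0"
  using triangle[of x "- x"] by simp

lemma triangle_diff: "N (x - y) \<le> N x + N y"
  using triangle[of x "- y"] by simp

lemma le_diameter_wrt:
  assumes "W \<subseteq> unit_ball N" "x \<in> W" "y \<in> W"
  shows "N (x - y) \<le> diameter_wrt N W"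
proof -
  have "bdd_above ((\<lambda>(x, y). N (x - y)) ` (W \<times> W))"
  proof (rule bdd_aboveI2[where M = 2], clarify)
    fix x y assume "x \<in> W" "y \<in> W"
    then have "N x \<le> 1" "N y \<le> 1" using assms(1) by (auto simp: unit_ball_def)
    then show "N (x - y) \<le> 2" using triangle_diff[of x y] by linarith
  qed
  then show ?thesis
    unfolding diameter_wrt_def using assms(2,3) cSUP_upper[of "(x, y)" "W \<times> W"] by fastforce
qed

text \<open>A relatively open set of diameter below \<epsilon> has only \<epsilon>-points.
  Conversely, the neighbourhood of an \<open>\<epsilon> / 3\<close>-point has diameter at most
  \<open>2 * \<epsilon> / 3\<close>, strictly below \<epsilon>.\<close>

lemma BHP_iff: "BHP N \<longleftrightarrow> (\<forall>\<epsilon>>0. \<exists>x. N x \<le> 1 \<and> small_point N \<epsilon> x)"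
proof (intro iffI allI impI)
  fix \<epsilon> :: real assume "BHP N" "\<epsilon> > 0"
  then obtain W where W: "openin (subtopology (weak_topology N) (unit_ball N)) W" "W \<noteq> {}"
    "diameter_wrt N W < \<epsilon>"
    unfolding BHP_def by blast
  then obtain x U where x: "x \<in> W" and U: "openin (weak_topology N) U" "W = U \<inter> unit_ball N"
    unfolding openin_subtopology by blast
  then obtain F \<eta> where F: "finite F" "F \<subseteq> dual_wrt N" "\<eta> > 0" "weak_nbhd F \<eta> x \<subseteq> U"
    by (metis IntD1 weak_nbhd_base)
  have "N (y - x) \<le> \<epsilon>" if "y \<in> weak_nbhd F \<eta> x" "N y \<le> 1" for y
  proof -
    have "y \<in> W" using that F(4) U(2) by (auto simp: unit_ball_def)
    then show ?thesis using le_diameter_wrt[of W y x] x W(3) U(2) by auto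
  qed
  then have "small_point N \<epsilon> x" unfolding small_point_def using F by blast
  moreover have "N x \<le> 1" using x U(2) by (simp add: unit_ball_def)
  ultimately show "\<exists>x. N x \<le> 1 \<and> small_point N \<epsilon> x" by blast
next
  assume R: "\<forall>\<epsilon>>0. \<exists>x. N x \<le> 1 \<and> small_point N \<epsilon> x"
  show "BHP N" unfolding BHP_def
  proof (intro allI impI)
    fix \<epsilon> :: real assume "\<epsilon> > 0"
    then obtain x where x: "N x \<le> 1" "small_point N (\<epsilon> / 3) x"
      using R by (metis divide_pos_pos zero_less_numeral)
    then obtain F \<eta> where F: "finite F" "F \<subseteq> dual_wrt N" "\<eta> > 0"
      "\<And>y. y \<in> weak_nbhd F \<eta> x \<Longrightarrow> N y \<le> 1 \<Longrightarrow> N (y - x) \<le> \<epsilon> / 3"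
      unfolding small_point_def by blast
    define W where "W = weak_nbhd F \<eta> x \<inter> unit_ball N"
    have "openin (subtopology (weak_topology N) (unit_ball N)) W"
      unfolding W_def openin_subtopology using openin_weak_nbhd[OF nonneg F(1,2)] by blast
    moreover have "x \<in> W"
      using x(1) F(2,3) by (auto simp: linear_0 dual_wrt_def W_def weak_nbhd_def unit_ball_def)
    then have "W \<noteq> {}" by blast
    moreover have "diameter_wrt N W \<le> 2 * \<epsilon> / 3"
      unfolding diameter_wrt_def
    proof (rule cSUP_least, use \<open>W \<noteq> {}\<close> in blast, clarify)
      fix y z assume "y \<in> W" "z \<in> W"
      then have "N (y - x) \<le> \<epsilon> / 3" "N (z - x) \<le> \<epsilon> / 3"
        using F(4) by (auto simp: W_def unit_ball_def)
      then show "N (y - z) \<le> 2 * \<epsilon> / 3"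
        using triangle_diff[of "y - x" "z - x"] by simp
    qed
    ultimately show "\<exists>W. openin (subtopology (weak_topology N) (unit_ball N)) W \<and> W \<noteq> {} \<and>
        diameter_wrt N W < \<epsilon>"
      using \<open>\<epsilon> > 0\<close> by (intro exI[of _ W]) auto
  qed
qed

lemma small_point_translate:
  assumes "small_point N \<epsilon> x" "N x < 1 - \<epsilon>" "0 \<le> \<epsilon>"
  shows "small_point N \<epsilon> u"
proof -
  obtain F \<eta> where F: "finite F" "F \<subseteq> dual_wrt N" "\<eta> > 0"
    "\<And>y. y \<in> weak_nbhd F \<eta> x \<Longrightarrow> N y \<le> 1 \<Longrightarrow> N (y - x) \<le> \<epsilon>"
    using assms(1) unfolding small_point_def by blast
  have small: "N (y - x) \<le> \<epsilon>" if y: "y \<in> weak_nbhd F \<eta> x" for y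
  proof (rule ccontr)
    assume d: "\<not> N (y - x) \<le> \<epsilon>"
    \<comment> \<open>\<open>w\<close> is the point of the segment from \<open>x\<close> to
      \<open>y\<close> at distance \<open>c\<close> from \<open>x\<close>. As
      \<open>c \<le> 1 - N x\<close> it stays in the ball, and as \<open>c > \<epsilon>\<close> it
      contradicts the choice of the neighbourhood.\<close>
    define c where "c = min (N (y - x)) (1 - N x)"
    define t where "t = c / N (y - x)"
    define w where "w = x + t *\<^sub>R (y - x)"
    have c: "c > \<epsilon>" "c \<le> N (y - x)" "c \<le> 1 - N x"
      using d assms(2) by (auto simp: c_def)
    have t: "0 \<le> t" "t \<le> 1" "t * N (y - x) = c"
      using c d assms(3) by (auto simp: t_def)
    have "\<bar>f (w - x)\<bar> < \<eta>" if "f \<in> F" for f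
    proof -
      have "f (w - x) = t * f (y - x)"
        using that F(2) by (auto simp: w_def dual_wrt_def linear_cmul)
      then have "\<bar>f (w - x)\<bar> \<le> \<bar>f (y - x)\<bar>"
        using t by (simp add: abs_mult mult_left_le_one_le)
      then show ?thesis using y that by (fastforce simp: weak_nbhd_def)
    qed
    then have "w \<in> weak_nbhd F \<eta> x" by (simp add: weak_nbhd_def)
    moreover have "N (w - x) = c" using t by (simp add: w_def scale)
    moreover from this have "N w \<le> 1" using triangle[of x "w - x"] c by simp
    ultimately show False using F(4) c(1) by fastforce
  qed
  \<comment> \<open>\<open>small\<close> holds without restriction to the ball, so it survives
    translation from \<open>x\<close> to \<open>u\<close>.\<close>
  have "N (y - u) \<le> \<epsilon>" if "y \<in> weak_nbhd F \<eta> u" for y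
    using small[of "x + (y - u)"] that by (simp add: weak_nbhd_def)
  then show ?thesis unfolding small_point_def using F by blast
qed

text \<open>An \<epsilon>-point of too small norm makes all vectors \<epsilon>-points, in particular
  the normalized \<open>v\<close>.\<close>

lemma BHP_near_sphere:
  assumes "BHP N" "N v \<noteq> 0" "\<epsilon> > 0"
  obtains x where "N x \<le> 1" "1 - \<epsilon> \<le> N x" "small_point N \<epsilon> x"
proof -
  obtain x where x: "N x \<le> 1" "small_point N \<epsilon> x"
    using assms BHP_iff by blast
  show thesis
  proof (cases "1 - \<epsilon> \<le> N x")
    case True
    then show ?thesis using x that by blast
  next
    case False
    have "N (v /\<^sub>R N v) = 1" using assms(2) nonneg[of v] by (simp add: scale)
    then show ?thesis
      using that[of "v /\<^sub>R N v"] small_point_translate[OF x(2)] False assms(3) by simp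
  qed
qed

end

lemma seminorm_norm: "seminorm (norm :: 'a::real_normed_vector \<Rightarrow> real)"
  by unfold_locales (auto simp: norm_triangle_ineq)

section \<open>The p-sum norm\<close>

text \<open>For positive \<open>a\<close>, \<open>b\<close> this is convexity of the power function;
  if one of them vanishes, \<open>r powr p \<le> r\<close> on the unit interval suffices.\<close>

lemma powr_convex_nonneg:
  fixes a b s t p :: real
  assumes "1 \<le> p" "0 \<le> a" "0 \<le> b" "0 \<le> s" "0 \<le> t" "s + t = 1"
  shows "(s * a + t * b) powr p \<le> s * a powr p + t * b powr p"
proof -
  have *: "(r * c) powr p \<le> r * c powr p" if "0 \<le> r" "r \<le> 1" for r c :: real
  proof -
    have "r powr p \<le> r"
      using powr_mono'[of 1 p r] assms(1) that by simp
    then show ?thesis by (simp add: powr_mult mult_right_mono)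
  qed
  consider "a = 0" | "b = 0" | "a > 0" "b > 0" using assms by linarith
  then show ?thesis
  proof cases
    case 3
    then show ?thesis
      using convex_onD[OF powr_convex[OF assms(1)], of t a b] assms
      by (simp add: eq_diff_eq[symmetric])
  qed (use * assms in auto)
qed

lemma psum_norm_powr:
  assumes "1 \<le> p"
  shows "psum_norm p (x, y) powr p = norm x powr p + norm y powr p"
  using assms by (simp add: psum_norm_def powr_powr)

lemma psum_norm_nonneg: "0 \<le> psum_norm p z"
  by (cases z) (simp add: psum_norm_def)

lemma psum_norm_le_iff:
  assumes "1 \<le> p" "0 \<le> r"
  shows "psum_norm p (x, y) \<le> r \<longleftrightarrow> norm x powr p + norm y powr p \<le> r powr p"
proof -
  have "psum_norm p (x, y) \<le> r \<longleftrightarrow> psum_norm p (x, y) powr p \<le> r powr p"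
    using assms psum_norm_nonneg[of p "(x, y)"]
    by (smt (verit) powr_less_mono2 powr_mono2)
  then show ?thesis using assms(1) by (simp add: psum_norm_powr)
qed

lemma psum_norm_Pair_zero [simp]: "1 \<le> p \<Longrightarrow> psum_norm p (x, 0) = norm x"
  by (simp add: psum_norm_def powr_powr)

lemma psum_norm_swap [simp]: "psum_norm p (prod.swap z) = psum_norm p z"
  by (cases z) (simp add: psum_norm_def add.commute)

lemma norm_fst_le_psum_norm: "norm x \<le> psum_norm p (x, y)" if "1 \<le> p"
proof -
  have "norm x powr p + norm y powr p \<le> psum_norm p (x, y) powr p"
    using that by (simp add: psum_norm_powr)
  then have "norm x powr p \<le> psum_norm p (x, y) powr p"
    by (smt (verit) powr_ge_zero)
  then show ?thesis
    using that psum_norm_nonneg[of p "(x, y)"] by (smt (verit) powr_less_mono2)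
qed

text \<open>Minkowski's inequality: with \<open>s\<close>, \<open>t\<close> the norms of
  \<open>u\<close>, \<open>v\<close>, each coordinate of \<open>(u + v) / (s + t)\<close> is a
  convex combination, with weights \<open>s / (s + t)\<close> and \<open>t / (s + t)\<close>, of
  those of \<open>u / s\<close> and \<open>v / t\<close>. Convexity of the power is applied
  coordinatewise and the bounds are added.\<close>

lemma psum_norm_triangle:
  fixes u v :: "'a::real_normed_vector \<times> 'b::real_normed_vector"
  assumes p: "1 \<le> p"
  shows "psum_norm p (u + v) \<le> psum_norm p u + psum_norm p v"
proof -
  obtain x y x' y' where uv: "u = (x, y)" "v = (x', y')" by (metis surj_pair)
  define s where "s = psum_norm p u"
  define t where "t = psum_norm p v"
  \<comment> \<open>Definiteness settles the cases \<open>s = 0\<close> and \<open>t = 0\<close>,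
    where normalizing is impossible.\<close>
  have zero: "z = 0" if "psum_norm p z = 0" for z :: "'a \<times> 'b"
  proof (cases z)
    case (Pair a b)
    then show ?thesis
      using that norm_fst_le_psum_norm[OF p, of a b]
        norm_fst_le_psum_norm[OF p, of b a] psum_norm_swap[of p z] by (auto simp: zero_prod_def)
  qed
  consider "s = 0" | "t = 0" | "s > 0" "t > 0"
    using psum_norm_nonneg[of p] by (metis s_def t_def less_eq_real_def)
  then show ?thesis
  proof cases
    case 3
    define R where "R a b = s / (s + t) * (a powr p / s powr p) + t / (s + t) * (b powr p / t powr p)"
      for a b
    \<comment> \<open>The fresh type \<open>'c\<close> lets the fact apply to both
      coordinates.\<close>
    have *: "norm (a + b) powr p \<le> R (norm a) (norm b) * (s + t) powr p"
      for a b :: "'c::real_normed_vector"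
    proof -
      have eq: "s / (s + t) * (norm a / s) + t / (s + t) * (norm b / t) = (norm a + norm b) / (s + t)"
        using 3 by (simp add: add_divide_distrib)
      have "norm (a + b) powr p \<le> (norm a + norm b) powr p"
        using p by (simp add: powr_mono2 norm_triangle_ineq)
      also have "\<dots> = ((norm a + norm b) / (s + t)) powr p * (s + t) powr p"
        using 3 by (simp add: powr_divide)
      also have "\<dots> \<le> R (norm a) (norm b) * (s + t) powr p"
        using powr_convex_nonneg[OF p, of "norm a / s" "norm b / t" "s / (s + t)" "t / (s + t)"] 3 eq
        by (intro mult_right_mono) (simp_all add: R_def powr_divide add_divide_distrib[symmetric])
      finally show ?thesis .
    qed
    have sp: "norm x powr p + norm y powr p = s powr p" and tp: "norm x' powr p + norm y' powr p = t powr p"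
      using p by (simp_all add: s_def t_def uv psum_norm_powr)
    have "R (norm x) (norm x') + R (norm y) (norm y')
        = s / (s + t) * ((norm x powr p + norm y powr p) / s powr p)
          + t / (s + t) * ((norm x' powr p + norm y' powr p) / t powr p)"
      by (simp add: R_def add_divide_distrib distrib_left)
    also have "\<dots> = 1"
      unfolding sp tp using 3 by (simp add: add_divide_distrib[symmetric])
    finally have "R (norm x) (norm x') * (s + t) powr p + R (norm y) (norm y') * (s + t) powr p
        = (s + t) powr p"
      by (simp add: distrib_right[symmetric])
    then have "norm (x + x') powr p + norm (y + y') powr p \<le> (s + t) powr p"
      using *[of x x'] *[of y y'] by linarith
    then show ?thesis
      using 3 psum_norm_le_iff[OF p, of "s + t" "x + x'" "y + y'"] by (simp add: uv s_def t_def)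
  qed (use zero[of u] zero[of v] in \<open>auto simp: s_def t_def psum_norm_nonneg\<close>)
qed

lemma seminorm_psum_norm:
  assumes "1 \<le> p"
  shows "seminorm (psum_norm p :: 'a::real_normed_vector \<times> 'b::real_normed_vector \<Rightarrow> real)"
proof
  fix a :: real and z :: "'a \<times> 'b"
  show "psum_norm p (a *\<^sub>R z) = \<bar>a\<bar> * psum_norm p z"
    using assms
    by (cases z) (simp add: psum_norm_def powr_mult powr_powr distrib_left[symmetric])
qed (rule psum_norm_triangle[OF assms])

lemma psum_norm_le_add: "psum_norm p (x, y) \<le> norm x + norm y" if "1 \<le> p"
  for x :: "'a::real_normed_vector" and y :: "'b::real_normed_vector"
  using psum_norm_triangle[OF that, of "(x, 0)" "(0, y)"] that
    psum_norm_swap[of p "(y, 0 :: 'a)"]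
  by simp

section \<open>Weak continuity of projection, embedding and swap\<close>

lemma dual_wrt_psum_norm_comp_fst:
  assumes "1 \<le> p" "f \<in> dual_wrt norm"
  shows "(\<lambda>z. f (fst z)) \<in> dual_wrt (psum_norm p)"
proof -
  obtain K where f: "linear f" "\<And>x. \<bar>f x\<bar> \<le> K * norm x"
    using assms(2) by (auto simp: dual_wrt_def)
  have "\<bar>f (fst z)\<bar> \<le> \<bar>K\<bar> * psum_norm p z" for z
  proof -
    have "\<bar>f (fst z)\<bar> \<le> \<bar>K\<bar> * norm (fst z)"
      using f(2)[of "fst z"] by (smt (verit) mult_right_mono norm_ge_zero)
    also have "\<dots> \<le> \<bar>K\<bar> * psum_norm p z"
      using norm_fst_le_psum_norm[OF assms(1), of "fst z" "snd z"] by (simp add: mult_left_mono)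
    finally show ?thesis .
  qed
  then show ?thesis
    using linear_compose[OF linear_fst f(1)] unfolding dual_wrt_def o_def by blast
qed

lemma dual_wrt_psum_norm_Pair_zero:
  assumes "1 \<le> p" "f \<in> dual_wrt (psum_norm p)"
  shows "(\<lambda>x. f (x, 0)) \<in> dual_wrt norm"
proof -
  obtain K where f: "linear f" "\<And>z. \<bar>f z\<bar> \<le> K * psum_norm p z"
    using assms(2) by (auto simp: dual_wrt_def)
  have "linear (\<lambda>x. (x, 0))" by (rule linearI) auto
  then have "linear (\<lambda>x. f (x, 0))"
    using linear_compose[OF _ f(1)] by (simp add: o_def)
  moreover have "\<bar>f (x, 0)\<bar> \<le> K * norm x" for x
    using f(2)[of "(x, 0)"] assms(1) by simp
  ultimately show ?thesis by (auto simp: dual_wrt_def)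
qed

text \<open>Swapping is a linear isometry, so functionals are transported by composition. Hence
  later arguments need to treat the first coordinate only.\<close>

lemma small_point_psum_norm_swap:
  assumes "small_point (psum_norm p) \<epsilon> z"
  shows "small_point (psum_norm p) \<epsilon> (prod.swap z)"
proof -
  obtain F \<eta> where F: "finite F" "F \<subseteq> dual_wrt (psum_norm p)" "\<eta> > 0"
    "\<And>w. w \<in> weak_nbhd F \<eta> z \<Longrightarrow> psum_norm p w \<le> 1 \<Longrightarrow> psum_norm p (w - z) \<le> \<epsilon>"
    using assms unfolding small_point_def by blast
  let ?F = "(\<lambda>f w. f (prod.swap w)) ` F"
  have swap_diff: "prod.swap (a - b) = prod.swap a - prod.swap b" for a b :: "'x::minus \<times> 'y::minus"
    by (cases a; cases b) simp
  have "?F \<subseteq> dual_wrt (psum_norm p)"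
  proof clarify
    fix f assume "f \<in> F"
    then obtain K where f: "linear f" "\<And>z. \<bar>f z\<bar> \<le> K * psum_norm p z"
      using F(2) unfolding dual_wrt_def by blast
    have "linear prod.swap" by (rule linearI) auto
    then have "linear (\<lambda>w. f (prod.swap w))"
      using linear_compose[OF _ f(1)] by (simp add: o_def)
    moreover have "\<bar>f (prod.swap w)\<bar> \<le> K * psum_norm p w" for w
      using f(2)[of "prod.swap w"] by simp
    ultimately show "(\<lambda>w. f (prod.swap w)) \<in> dual_wrt (psum_norm p)"
      unfolding dual_wrt_def by blast
  qed
  moreover have "psum_norm p (w - prod.swap z) \<le> \<epsilon>"
    if "w \<in> weak_nbhd ?F \<eta> (prod.swap z)" "psum_norm p w \<le> 1" for w
  proof -
    have "prod.swap w \<in> weak_nbhd F \<eta> z"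
      using that(1) by (simp add: weak_nbhd_def swap_diff)
    then have "psum_norm p (prod.swap w - z) \<le> \<epsilon>"
      using F(4) that(2) by simp
    then show ?thesis
      using psum_norm_swap[of p "prod.swap w - z"] by (simp add: swap_diff)
  qed
  ultimately show ?thesis
    unfolding small_point_def using F(1,3) by (intro exI[of _ ?F] exI[of _ \<eta>]) auto
qed

lemma BHP_psum_norm_swap:
  assumes "1 \<le> p"
    and "BHP (psum_norm p :: 'a::real_normed_vector \<times> 'b::real_normed_vector \<Rightarrow> real)"
  shows "BHP (psum_norm p :: 'b \<times> 'a \<Rightarrow> real)"
  unfolding seminorm.BHP_iff[OF seminorm_psum_norm[OF assms(1)]]
proof (intro allI impI)
  fix \<epsilon> :: real assume "\<epsilon> > 0"
  then obtain z :: "'a \<times> 'b" where "psum_norm p z \<le> 1" "small_point (psum_norm p) \<epsilon> z"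
    using assms(2) unfolding seminorm.BHP_iff[OF seminorm_psum_norm[OF assms(1)]] by blast
  then show "\<exists>w :: 'b \<times> 'a. psum_norm p w \<le> 1 \<and> small_point (psum_norm p) \<epsilon> w"
    using small_point_psum_norm_swap by (intro exI[of _ "prod.swap z"]) simp
qed

section \<open>From a summand to the sum\<close>

text \<open>A nearby \<open>(a, b)\<close> in the ball has
  \<open>norm a \<ge> 1 - 2 * \<delta>\<close>: one \<delta> is lost from \<open>norm x\<close>, one
  from \<open>norm (a - x)\<close>. This leaves at most \<open>1 - (1 - 2 * \<delta>) powr p\<close>
  for \<open>norm b powr p\<close>.\<close>

lemma small_point_psum_norm_Pair_zero:
  assumes p: "1 \<le> p" and x: "small_point norm \<delta> x" "1 - \<delta> \<le> norm x" and \<delta>: "\<delta> \<le> 1 / 2"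
  shows "small_point (psum_norm p) (\<delta> + (1 - (1 - 2 * \<delta>) powr p) powr (1 / p)) (x, 0)"
proof -
  obtain F \<eta> where F: "finite F" "F \<subseteq> dual_wrt norm" "\<eta> > 0"
    "\<And>w. w \<in> weak_nbhd F \<eta> x \<Longrightarrow> norm w \<le> 1 \<Longrightarrow> norm (w - x) \<le> \<delta>"
    using x(1) unfolding small_point_def by blast
  let ?F = "(\<lambda>f z. f (fst z)) ` F"
  have "psum_norm p (z - (x, 0)) \<le> \<delta> + (1 - (1 - 2 * \<delta>) powr p) powr (1 / p)"
    if z: "z \<in> weak_nbhd ?F \<eta> (x, 0)" "psum_norm p z \<le> 1" for z
  proof -
    obtain a b where ab: "z = (a, b)" by (cases z)
    have "a \<in> weak_nbhd F \<eta> x" using z(1) by (simp add: weak_nbhd_def ab)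
    moreover have "norm a \<le> 1"
      using z(2) norm_fst_le_psum_norm[OF p, of a b] by (simp add: ab)
    ultimately have a: "norm (a - x) \<le> \<delta>" using F(4) by blast
    then have "1 - 2 * \<delta> \<le> norm a"
      using x(2) norm_triangle_ineq2[of x a] by (simp add: norm_minus_commute)
    then have "(1 - 2 * \<delta>) powr p \<le> norm a powr p"
      using p \<delta> by (intro powr_mono2) auto
    moreover have "norm a powr p + norm b powr p \<le> 1"
      using z(2) psum_norm_le_iff[OF p, of 1 a b] by (simp add: ab)
    ultimately have "norm b powr p \<le> 1 - (1 - 2 * \<delta>) powr p" by simp
    then have "(norm b powr p) powr (1 / p) \<le> (1 - (1 - 2 * \<delta>) powr p) powr (1 / p)"
      using p by (intro powr_mono2) auto
    then have "norm b \<le> (1 - (1 - 2 * \<delta>) powr p) powr (1 / p)"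
      using p by (simp add: powr_powr)
    then show ?thesis
      using a psum_norm_le_add[OF p, of "a - x" b] by (simp add: ab)
  qed
  moreover have "?F \<subseteq> dual_wrt (psum_norm p)"
    using F(2) dual_wrt_psum_norm_comp_fst[OF p] by auto
  ultimately show ?thesis
    unfolding small_point_def using F(1,3) by (intro exI[of _ ?F] exI[of _ \<eta>]) auto
qed

lemma small_point_mono: "small_point N \<epsilon> x \<Longrightarrow> \<epsilon> \<le> \<epsilon>' \<Longrightarrow> small_point N \<epsilon>' x"
  unfolding small_point_def by (meson order_trans)

lemma BHP_psum_norm_fst:
  assumes p: "1 \<le> p" and X: "\<exists>x :: 'a::real_normed_vector. x \<noteq> 0" "BHP (norm :: 'a \<Rightarrow> real)"
  shows "BHP (psum_norm p :: 'a \<times> 'b::real_normed_vector \<Rightarrow> real)"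
  unfolding seminorm.BHP_iff[OF seminorm_psum_norm[OF p]]
proof (intro allI impI)
  fix \<epsilon> :: real assume "\<epsilon> > 0"
  \<comment> \<open>The radius above tends to 0 with \<delta>, so some \<delta> below
    \<open>1 / 2\<close> brings it under \<epsilon>.\<close>
  have "((\<lambda>\<delta>. \<delta> + (1 - (1 - 2 * \<delta>) powr p) powr (1 / p)) \<longlongrightarrow>
      0 + (1 - (1 - 2 * 0) powr p) powr (1 / p)) (at_right 0)"
  proof (intro tendsto_intros)
    \<comment> \<open>The base of the outer power tends to 0, where the limit rule for
      \<open>powr\<close> asks for a positive exponent and an eventually nonnegative base.\<close>
    have "eventually (\<lambda>\<delta>::real. \<delta> < 1 / 2) (at_right 0)"
      by (rule eventually_at_right_real[THEN eventually_mono, of 0 "1 / 2"]) auto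
    moreover have "eventually (\<lambda>\<delta>::real. 0 < \<delta>) (at_right 0)"
      by (simp add: eventually_at_right_less)
    ultimately have "eventually (\<lambda>\<delta>::real. 0 \<le> 1 - (1 - 2 * \<delta>) powr p) (at_right 0)"
    proof eventually_elim
      case (elim \<delta>)
      then show ?case using p powr_le1[of p "1 - 2 * \<delta>"] by simp
    qed
    then show "1 - (1 - 2 * 0) powr p \<noteq> 0 \<or>
        1 / p > 0 \<and> eventually (\<lambda>\<delta>::real. 0 \<le> 1 - (1 - 2 * \<delta>) powr p) (at_right 0)"
      using p by simp
  qed (use p in auto)
  then have "eventually (\<lambda>\<delta>. \<delta> + (1 - (1 - 2 * \<delta>) powr p) powr (1 / p) < \<epsilon>) (at_right 0)"
    using \<open>\<epsilon> > 0\<close> by (intro order_tendstoD(2)) auto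
  then have "eventually (\<lambda>\<delta>. \<delta> + (1 - (1 - 2 * \<delta>) powr p) powr (1 / p) < \<epsilon> \<and> \<delta> \<in> {0<..<1/2})
      (at_right 0)"
    by (intro eventually_conj eventually_at_right_real) auto
  then obtain \<delta> where \<delta>: "\<delta> + (1 - (1 - 2 * \<delta>) powr p) powr (1 / p) < \<epsilon>" "0 < \<delta>" "\<delta> < 1 / 2"
    using eventually_happens'[of "at_right (0::real)"] by fastforce
  obtain v :: 'a where "norm v \<noteq> 0" using X(1) by auto
  then obtain x :: 'a where x: "norm x \<le> 1" "1 - \<delta> \<le> norm x" "small_point norm \<delta> x"
    using seminorm.BHP_near_sphere[OF seminorm_norm X(2)] \<delta>(2) by metis
  have "small_point (psum_norm p) \<epsilon> (x, 0 :: 'b)"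
    using small_point_psum_norm_Pair_zero[OF p x(3,2)] \<delta> by (auto intro: small_point_mono)
  moreover have "psum_norm p (x, 0 :: 'b) \<le> 1" using p x(1) by simp
  ultimately show "\<exists>z :: 'a \<times> 'b. psum_norm p z \<le> 1 \<and> small_point (psum_norm p) \<epsilon> z"
    by blast
qed

section \<open>From the sum to a summand\<close>

text \<open>With \<open>y\<close> frozen, \<open>w \<mapsto> (norm x *\<^sub>R w, y)\<close> maps
  the unit ball of the first space into that of the sum and the normalized \<open>x\<close> to
  \<open>(x, y)\<close>. It multiplies distances by \<open>norm x\<close>, hence the
  quotients.\<close>

lemma small_point_psum_norm_fst:
  assumes p: "1 \<le> p" and xy: "small_point (psum_norm p) \<epsilon> (x, y)" "psum_norm p (x, y) \<le> 1"
    and "x \<noteq> 0"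
  shows "small_point norm (\<epsilon> / norm x) (x /\<^sub>R norm x)"
proof -
  obtain F \<eta> where F: "finite F" "F \<subseteq> dual_wrt (psum_norm p)" "\<eta> > 0"
    "\<And>w. w \<in> weak_nbhd F \<eta> (x, y) \<Longrightarrow> psum_norm p w \<le> 1 \<Longrightarrow> psum_norm p (w - (x, y)) \<le> \<epsilon>"
    using xy(1) unfolding small_point_def by blast
  define a where "a = norm x"
  have "a > 0" using assms(4) by (simp add: a_def)
  let ?F = "(\<lambda>f x. f (x, 0)) ` F"
  have "norm (w - x /\<^sub>R a) \<le> \<epsilon> / a" if w: "w \<in> weak_nbhd ?F (\<eta> / a) (x /\<^sub>R a)" "norm w \<le> 1" for w
  proof -
    have eq: "(a *\<^sub>R w, y) - (x, y) = a *\<^sub>R (w - x /\<^sub>R a, 0)"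
      using \<open>a > 0\<close> by (simp add: scaleR_diff_right)
    have "\<bar>f ((a *\<^sub>R w, y) - (x, y))\<bar> < \<eta>" if "f \<in> F" for f
    proof -
      have "f ((a *\<^sub>R w, y) - (x, y)) = a * f (w - x /\<^sub>R a, 0)"
        unfolding eq using that F(2) by (auto simp: dual_wrt_def linear_cmul simp del: scaleR_Pair)
      moreover have "\<bar>f (w - x /\<^sub>R a, 0)\<bar> < \<eta> / a"
        using that w(1) by (simp add: weak_nbhd_def)
      ultimately show ?thesis using \<open>a > 0\<close> by (simp add: abs_mult field_simps)
    qed
    then have "(a *\<^sub>R w, y) \<in> weak_nbhd F \<eta> (x, y)" by (simp add: weak_nbhd_def)
    moreover have "psum_norm p (a *\<^sub>R w, y) \<le> 1"
    proof -
      have "norm (a *\<^sub>R w) \<le> norm x"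
        using w(2) \<open>a > 0\<close> by (simp add: a_def mult_left_le)
      then have "norm (a *\<^sub>R w) powr p \<le> norm x powr p"
        using p by (intro powr_mono2) auto
      then show ?thesis
        using xy(2) psum_norm_le_iff[OF p, of 1 x y] psum_norm_le_iff[OF p, of 1 "a *\<^sub>R w" y] by simp
    qed
    ultimately have "psum_norm p ((a *\<^sub>R w, y) - (x, y)) \<le> \<epsilon>" by (rule F(4))
    then have "a * norm (w - x /\<^sub>R a) \<le> \<epsilon>"
      unfolding eq using p \<open>a > 0\<close>
      by (simp add: seminorm.scale[OF seminorm_psum_norm] del: scaleR_Pair)
    then show ?thesis using \<open>a > 0\<close> by (simp add: field_simps)
  qed
  moreover have "?F \<subseteq> dual_wrt norm"
    using F(2) dual_wrt_psum_norm_Pair_zero[OF p] by auto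
  ultimately show ?thesis
    unfolding small_point_def a_def[symmetric] using F(1,3) \<open>a > 0\<close>
    by (intro exI[of _ ?F] exI[of _ "\<eta> / a"]) auto
qed

theorem proposition2p8:
  fixes p :: real
  assumes "\<exists>x :: 'a::banach. x \<noteq> 0"
    and "\<exists>y :: 'b::banach. y \<noteq> 0"
    and "1 \<le> p"
  shows "BHP (psum_norm p :: 'a \<times> 'b \<Rightarrow> real) \<longleftrightarrow>
    BHP (norm :: 'a \<Rightarrow> real) \<or> BHP (norm :: 'b \<Rightarrow> real)"
proof
  assume "BHP (norm :: 'a \<Rightarrow> real) \<or> BHP (norm :: 'b \<Rightarrow> real)"
  then show "BHP (psum_norm p :: 'a \<times> 'b \<Rightarrow> real)"
    using BHP_psum_norm_fst[OF assms(3,1)] BHP_psum_norm_fst[OF assms(3,2)]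
      BHP_psum_norm_swap[OF assms(3)] by blast
next
  assume Z: "BHP (psum_norm p :: 'a \<times> 'b \<Rightarrow> real)"
  \<comment> \<open>Stated for fresh types \<open>'c\<close>, \<open>'d\<close> so that it serves
    \<open>(x, y)\<close> and the swapped pair \<open>(y, x)\<close>. The factor 4 comes from
    \<open>norm x \<ge> 1 / 4\<close>.\<close>
  have normalize: "small_point norm (4 * \<epsilon>) (x /\<^sub>R norm x) \<and> norm (x /\<^sub>R norm x) \<le> 1"
    if "small_point (psum_norm p) \<epsilon> (x, y)" "psum_norm p (x, y) \<le> 1" "1 / 4 \<le> norm x" "\<epsilon> > 0"
    for \<epsilon> and x :: "'c::real_normed_vector" and y :: "'d::real_normed_vector"
  proof -
    have "\<epsilon> / norm x \<le> \<epsilon> / (1 / 4)"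
      using that(3,4) by (intro divide_left_mono) auto
    moreover have "x \<noteq> 0" using that(3) by auto
    ultimately show ?thesis
      using small_point_psum_norm_fst[OF assms(3) that(1,2)] by (auto intro: small_point_mono)
  qed
  have step: "(\<exists>x :: 'a. norm x \<le> 1 \<and> small_point norm (4 * \<epsilon>) x) \<or>
      (\<exists>y :: 'b. norm y \<le> 1 \<and> small_point norm (4 * \<epsilon>) y)" if \<epsilon>: "0 < \<epsilon>" "\<epsilon> \<le> 1 / 2" for \<epsilon>
  proof -
    obtain v :: 'a where "v \<noteq> 0" using assms(1) by blast
    then have "psum_norm p (v, 0 :: 'b) \<noteq> 0" using assms(3) by simp
    then obtain z :: "'a \<times> 'b" where z: "psum_norm p z \<le> 1" "1 - \<epsilon> \<le> psum_norm p z"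
      "small_point (psum_norm p) \<epsilon> z"
      using seminorm.BHP_near_sphere[OF seminorm_psum_norm[OF assms(3)] Z] \<epsilon>(1) by metis
    obtain x y where xy: "z = (x, y)" by (cases z)
    \<comment> \<open>\<epsilon> is at most \<open>1 / 2\<close>, so \<open>z\<close> has norm at
      least \<open>1 / 2\<close> and one coordinate carries half of that.\<close>
    have "1 / 2 \<le> norm x + norm y"
      using z(2) \<epsilon>(2) psum_norm_le_add[OF assms(3), of x y] by (simp add: xy)
    then consider "1 / 4 \<le> norm x" | "1 / 4 \<le> norm y" by linarith
    then show ?thesis
    proof cases
      case 1
      then show ?thesis using normalize[of \<epsilon> x y] z \<epsilon> by (auto simp: xy)
    next
      case 2
      then show ?thesis
        using normalize[of \<epsilon> y x] z \<epsilon> small_point_psum_norm_swap[OF z(3)]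
          psum_norm_swap[of p z] by (auto simp: xy)
    qed
  qed
  show "BHP (norm :: 'a \<Rightarrow> real) \<or> BHP (norm :: 'b \<Rightarrow> real)"
  \<comment> \<open>Which summand \<open>step\<close> yields may depend on \<epsilon>. If both
    failed, at \<open>e1\<close> and \<open>e2\<close>, one \<epsilon> with
    \<open>4 * \<epsilon>\<close> below both thresholds would contradict
    \<open>step\<close>.\<close>
  proof (rule ccontr)
    assume "\<not> ?thesis"
    then obtain e1 e2 where e: "e1 > 0" "e2 > 0"
      "\<And>x :: 'a. norm x \<le> 1 \<Longrightarrow> \<not> small_point norm e1 x"
      "\<And>y :: 'b. norm y \<le> 1 \<Longrightarrow> \<not> small_point norm e2 y"
      unfolding seminorm.BHP_iff[OF seminorm_norm] by blast
    define \<epsilon> where "\<epsilon> = min (1 / 2) (min (e1 / 4) (e2 / 4))"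
    have "0 < \<epsilon>" "\<epsilon> \<le> 1 / 2" "4 * \<epsilon> \<le> e1" "4 * \<epsilon> \<le> e2"
      using e(1,2) by (auto simp: \<epsilon>_def)
    then show False using step[of \<epsilon>] e(3,4) by (metis small_point_mono)
  qed
qed

end
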